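(* Let $n>2$ be an integer and let $\zeta$ be a primitive $n$-th root of unity. Let $p_1,p_2,\dots$ be the primes that are not congruent to $1$ modulo $n$. Then $$R_+(\zeta)=\mathbb{Z}\left[\zeta,\frac1{p_1},\frac1{p_2},\dots\right].$$
   Context: For $\alpha\in\mathbb{C}$, $R_+(\alpha)$ denotes the set of all finite sums $\sum_{k\ge 0} a_k\binom{\alpha}{k}$ with $a_k\in\mathbb{Z}_{\ge 0}$, where $\binom{\alpha}{k}=\frac{\alpha(\alpha-1)\cdots(\alpha-k+1)}{k!}$. The right-hand side is the subring of $\mathbb{C}$ generated by the listed elements. *)

theory Defs
  imports
    "HOL-Algebra.Generated_Rings"
    "HOL-Algebra.Algebraic_Closure_Type"
    "HOL-Number_Theory.Cong"
    "HOL-Computational_Algebra.Primes"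
    Complex_Main
begin

definition R_plus :: "complex \<Rightarrow> complex set" where
  "R_plus \<alpha> = {\<Sum>k\<in>K. of_nat (a k) * (\<alpha> gchoose k) | (a :: nat \<Rightarrow> nat) K. finite K}"

definition primitive_root_of_unity :: "nat \<Rightarrow> complex \<Rightarrow> bool" where
  "primitive_root_of_unity n z \<longleftrightarrow> n > 0 \<and> z ^ n = 1 \<and> (\<forall>k. 0 < k \<and> k < n \<longrightarrow> z ^ k \<noteq> 1)"

(* generate_ring closes under 1, +, -, and *, i.e. it is the unital subring generated. *)
definition generated_subring :: "complex set \<Rightarrow> complex set" where
  "generated_subring S = generate_ring ring_of_type_algebra S"

end

theory Submission
  imports Defs "HOL-Number_Theory.Pocklington"
begin

text \<open>
  Multiplication by \<open>\<zeta>\<close> preserves \<open>R_plus \<zeta>\<close> because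
  \<open>x * (x gchoose k) = k * (x gchoose k) + (k + 1) * (x gchoose (k + 1))\<close>. As the powers of \<open>\<zeta>\<close> sum to
  zero, \<open>- x\<close> is the sum of \<open>\<zeta> ^ j * x\<close> over \<open>0 < j < n\<close>, so \<open>R_plus \<zeta>\<close> is closed under negation and
  consists of the values at \<open>\<zeta>\<close> of all integer-valued polynomials; in particular it is a ring.

  Let \<open>p\<close> be a prime not congruent to 1 and let \<open>\<eta> = \<zeta> ^ (p - 1)\<close>, of order \<open>d > 1\<close>. Fermat's little
  theorem makes \<open>(x ^ p - x) / p\<close> integer-valued, so \<open>(1 - \<eta>) / p\<close> lies in the ring. Now
  \<open>(1 - \<eta>) ^ (d - 1)\<close> divides \<open>d\<close>, whose \<open>p\<close>-adic valuation is less than \<open>d - 1\<close>, and hence \<open>1 / p\<close>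
  lies in the ring.

  Conversely, if \<open>p\<close> is congruent to 1, the integers modulo \<open>p ^ m\<close> contain an element \<open>r\<close> whose
  reduction modulo \<open>p\<close> still has order \<open>n\<close>. The falling factorial of degree \<open>k\<close> takes multiples of
  \<open>k!\<close> as values at the powers of \<open>r\<close>, so if \<open>p ^ m\<close> divides \<open>k!\<close>, it also divides the coefficients of
  this polynomial modulo \<open>x ^ n - 1\<close>. Thus no such \<open>p\<close> is left in the denominator of \<open>\<zeta> gchoose k\<close>.
\<close>

subsection \<open>Subrings of the complex numbers\<close>

locale complex_subring =
  fixes T :: "complex set"
  assumes one: "1 \<in> T"
    and uminus: "x \<in> T \<Longrightarrow> - x \<in> T"
    and add: "x \<in> T \<Longrightarrow> y \<in> T \<Longrightarrow> x + y \<in> T"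
    and mult: "x \<in> T \<Longrightarrow> y \<in> T \<Longrightarrow> x * y \<in> T"
begin

lemma zero: "0 \<in> T"
  using add[OF one uminus[OF one]] by simp

lemma of_nat: "of_nat m \<in> T"
  by (induction m) (auto intro: zero one add)

lemma of_int: "of_int m \<in> T"
  by (cases m rule: int_cases2) (auto intro: of_nat uminus)

lemma power: "x \<in> T \<Longrightarrow> x ^ m \<in> T"
  by (induction m) (auto intro: one mult)

lemma sum: "(\<And>i. i \<in> A \<Longrightarrow> f i \<in> T) \<Longrightarrow> sum f A \<in> T"
  by (induction A rule: infinite_finite_induct) (auto intro: zero add)

lemma prod: "(\<And>i. i \<in> A \<Longrightarrow> f i \<in> T) \<Longrightarrow> prod f A \<in> T"
  by (induction A rule: infinite_finite_induct) (auto intro: one mult)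

end

text \<open>\<open>a_inv\<close> is a definite description in the additive group, so uniqueness of
  inverses identifies it.\<close>

lemma a_inv_ring_of_type_algebra: "a_inv ring_of_type_algebra x = - x"
  for x :: "'a :: comm_ring_1"
  by (rule abelian_group.minus_equality[OF ring.is_abelian_group[OF ring_from_type_algebra]])
    (auto simp: ring_of_type_algebra_def)

lemma complex_subring_generated: "complex_subring (generated_subring S)"
proof -
  let ?R = "ring_of_type_algebra :: complex ring"
  show ?thesis
    unfolding generated_subring_def
  proof
    show "1 \<in> generate_ring ?R S"
      using generate_ring.one[of ?R S] by (simp add: ring_of_type_algebra_def)
  next
    fix x assume "x \<in> generate_ring ?R S"
    from generate_ring.a_inv[OF this] show "- x \<in> generate_ring ?R S"
      by (simp only: a_inv_ring_of_type_algebra)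
  next
    fix x y assume "x \<in> generate_ring ?R S" "y \<in> generate_ring ?R S"
    from generate_ring.eng_add[OF this] generate_ring.eng_mult[OF this]
    show "x + y \<in> generate_ring ?R S" "x * y \<in> generate_ring ?R S"
      by (simp_all add: ring_of_type_algebra_def)
  qed
qed

lemma generated_subring_incl: "x \<in> S \<Longrightarrow> x \<in> generated_subring S"
  unfolding generated_subring_def by (rule generate_ring.incl)

lemma (in complex_subring) generated_subring_subset:
  assumes "S \<subseteq> T"
  shows "generated_subring S \<subseteq> T"
proof
  let ?R = "ring_of_type_algebra :: complex ring"
  fix x assume "x \<in> generated_subring S"
  then show "x \<in> T"
    unfolding generated_subring_def
  proof (induction rule: generate_ring.induct)
    case (a_inv h)
    then show ?case by (simp only: a_inv_ring_of_type_algebra uminus)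
  qed (use assms one add mult in \<open>auto simp: ring_of_type_algebra_def\<close>)
qed

text \<open>Divide a Bezout relation between \<open>c\<close> and \<open>p\<close> by
  \<open>p\<close>.\<close>

lemma (in complex_subring) inverse_prime_dvd:
  assumes p: "Factorial_Ring.prime p" and c: "\<not> p dvd c"
    and mem: "of_nat c / of_nat p \<in> T"
  shows "1 / of_nat p \<in> T"
proof -
  have "p > 0" using p by (simp add: prime_gt_0_nat)
  have "coprime (int c) (int p)"
    using prime_imp_coprime[OF p c] by (simp add: coprime_commute)
  then obtain u v where "u * int c + v * int p = 1"
    using bezout_int[of "int c" "int p"] by auto
  then have "of_int u * of_nat c + of_int v * of_nat p = (1 :: complex)"
    by (metis of_int_1 of_int_add of_int_mult of_int_of_nat_eq)
  then have "1 / of_nat p = of_int u * (of_nat c / of_nat p) + (of_int v :: complex)"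
    using \<open>p > 0\<close> by (simp add: field_simps)
  then show ?thesis
    using mem by (simp only: add mult of_int)
qed

subsection \<open>Binomial combinations and integer-valued polynomials\<close>

lemma R_plus_zero: "0 \<in> R_plus \<alpha>"
  unfolding R_plus_def by (auto intro!: exI[of _ "{}"])

lemma R_plus_add:
  assumes "x \<in> R_plus \<alpha>" "y \<in> R_plus \<alpha>"
  shows "x + y \<in> R_plus \<alpha>"
proof -
  from assms obtain a K b L where
    x: "x = (\<Sum>k\<in>K. of_nat (a k) * (\<alpha> gchoose k))" "finite K" and
    y: "y = (\<Sum>k\<in>L. of_nat (b k) * (\<alpha> gchoose k))" "finite L"
    unfolding R_plus_def by blast
  \<comment> \<open>Extending both coefficient functions by zero puts the two sums over a common
    index set.\<close>
  let ?c = "\<lambda>k. (if k \<in> K then a k else 0) + (if k \<in> L then b k else 0)"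
  have "x = (\<Sum>k\<in>K \<union> L. of_nat (if k \<in> K then a k else 0) * (\<alpha> gchoose k))"
    unfolding x(1) using x(2) y(2) by (intro sum.mono_neutral_cong_left) auto
  moreover have "y = (\<Sum>k\<in>K \<union> L. of_nat (if k \<in> L then b k else 0) * (\<alpha> gchoose k))"
    unfolding y(1) using x(2) y(2) by (intro sum.mono_neutral_cong_left) auto
  ultimately have "x + y = (\<Sum>k\<in>K \<union> L. of_nat (?c k) * (\<alpha> gchoose k))"
    by (simp only: sum.distrib[symmetric] of_nat_add distrib_right)
  moreover have "finite (K \<union> L)" using x y by simp
  ultimately show ?thesis
    unfolding R_plus_def mem_Collect_eq by (intro exI[of _ ?c] exI[of _ "K \<union> L"]) simp
qed

lemma R_plus_gchoose: "\<alpha> gchoose k \<in> R_plus \<alpha>"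
  unfolding R_plus_def by (auto intro!: exI[of _ "\<lambda>_. 1"] exI[of _ "{k}"])

lemma R_plus_of_nat_mult: "x \<in> R_plus \<alpha> \<Longrightarrow> of_nat m * x \<in> R_plus \<alpha>"
  by (induction m) (auto simp: distrib_right intro: R_plus_zero R_plus_add)

lemma R_plus_sum: "(\<And>i. i \<in> A \<Longrightarrow> f i \<in> R_plus \<alpha>) \<Longrightarrow> sum f A \<in> R_plus \<alpha>"
  by (induction A rule: infinite_finite_induct) (auto intro: R_plus_zero R_plus_add)

lemma R_plus_mult_base:
  assumes "x \<in> R_plus \<alpha>"
  shows "\<alpha> * x \<in> R_plus \<alpha>"
proof -
  from assms obtain a K where x: "x = (\<Sum>k\<in>K. of_nat (a k) * (\<alpha> gchoose k))"
    unfolding R_plus_def by blast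
  have "\<alpha> * x = (\<Sum>k\<in>K. of_nat (a k) * (\<alpha> * (\<alpha> gchoose k)))"
    by (simp add: x sum_distrib_left mult_ac)
  also have "\<dots> \<in> R_plus \<alpha>"
    by (subst gbinomial_mult_1)
      (intro R_plus_sum R_plus_of_nat_mult R_plus_add R_plus_gchoose)
  finally show ?thesis .
qed

lemma R_plus_mult_base_power: "x \<in> R_plus \<alpha> \<Longrightarrow> \<alpha> ^ j * x \<in> R_plus \<alpha>"
  by (induction j) (auto simp: mult.assoc intro: R_plus_mult_base)

lemma sum_powers_root_of_unity:
  fixes z :: "'a :: field"
  assumes "z ^ n = 1" "z \<noteq> 1"
  shows "(\<Sum>j<n. z ^ j) = 0"
  using power_diff_1_eq[of z n] assms by simp

lemma R_plus_uminus:
  assumes "\<alpha> ^ n = 1" "\<alpha> \<noteq> 1" "n > 0" "x \<in> R_plus \<alpha>"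
  shows "- x \<in> R_plus \<alpha>"
proof -
  have "(\<Sum>j<n. \<alpha> ^ j) = 1 + (\<Sum>j\<in>{1..<n}. \<alpha> ^ j)"
    using \<open>n > 0\<close> by (simp add: lessThan_atLeast0 sum.atLeast_Suc_lessThan)
  then have "- 1 = (\<Sum>j\<in>{1..<n}. \<alpha> ^ j)"
    using sum_powers_root_of_unity[OF assms(1,2)] by (intro minus_unique) simp
  then have "- x = (\<Sum>j\<in>{1..<n}. \<alpha> ^ j * x)"
    by (metis sum_distrib_right mult_minus1)
  then show ?thesis
    using assms(4) by (auto intro: R_plus_sum R_plus_mult_base_power)
qed

text \<open>Generic in the ring because it serves twice: over \<open>int\<close> for divisibility by
  prime powers, over \<open>complex\<close> as a multiple of the binomial coefficient.\<close>

definition falling_poly :: "nat \<Rightarrow> 'a :: idom poly" where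
  "falling_poly k = (\<Prod>i<k. [:- of_nat i, 1:])"

lemma poly_falling_poly: "poly (falling_poly k) x = fact k * (x gchoose k)"
  for x :: "'a :: field_char_0"
  by (simp add: falling_poly_def poly_prod gbinomial_mult_fact lessThan_atLeast0)

lemma degree_falling_poly: "degree (falling_poly k) = k"
  by (simp add: falling_poly_def degree_prod_eq_sum_degree)

lemma falling_poly_Suc:
  "falling_poly (Suc k) = Polynomial.smult (- of_nat k) (falling_poly k) + pCons 0 (falling_poly k)"
  by (simp add: falling_poly_def mult.commute)

text \<open>On the right the inner coefficient is an integer; this carries divisibility results over
  \<open>int\<close> to the complex polynomial.\<close>

lemma of_int_coeff_falling_poly:
  "poly.coeff (falling_poly k) i = of_int (poly.coeff (falling_poly k) i)"
proof (induction k arbitrary: i)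
  case 0
  show ?case by (simp add: falling_poly_def coeff_1)
next
  case (Suc k)
  show ?case by (cases i) (simp_all add: falling_poly_Suc Suc[symmetric])
qed

lemma poly_falling_poly_int: "poly (falling_poly k) (int m) = fact k * int (m choose k)"
proof -
  \<comment> \<open>The product formula for \<open>gchoose\<close> needs a field, so the two
    integers are compared in \<open>real\<close>.\<close>
  have "of_int (poly (falling_poly k) (int m)) = (of_int (fact k * int (m choose k)) :: real)"
    by (simp add: falling_poly_def poly_prod gbinomial_mult_fact lessThan_atLeast0
        binomial_gbinomial)
  then show ?thesis by (simp only: of_int_eq_iff)
qed

text \<open>The matrix of the numbers \<open>i choose k\<close> is unitriangular, so the system can
  be solved over the integers row by row.\<close>

lemma newton_interpolation:
  fixes f :: "nat \<Rightarrow> int"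
  shows "\<exists>c :: nat \<Rightarrow> int. \<forall>i\<le>m. (\<Sum>k\<le>m. c k * int (i choose k)) = f i"
proof (induction m)
  case 0
  show ?case by (intro exI[of _ f]) simp
next
  case (Suc m)
  then obtain c :: "nat \<Rightarrow> int" where c: "\<And>i. i \<le> m \<Longrightarrow> (\<Sum>k\<le>m. c k * int (i choose k)) = f i"
    by blast
  \<comment> \<open>The new binomial vanishes at every \<open>i \<le> m\<close> and is 1 at
    \<open>Suc m\<close>, so its coefficient is the defect left there.\<close>
  define c' where "c' = c(Suc m := f (Suc m) - (\<Sum>k\<le>m. c k * int (Suc m choose k)))"
  have *: "(\<Sum>k\<le>m. c' k * int (i choose k)) = (\<Sum>k\<le>m. c k * int (i choose k))" for i
    by (intro sum.cong) (auto simp: c'_def)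
  have "(\<Sum>k\<le>Suc m. c' k * int (i choose k)) = f i" if "i \<le> Suc m" for i
    using that c[of i] by (cases "i = Suc m") (simp_all add: * c'_def)
  then show ?case by blast
qed

text \<open>The Newton interpolant at \<open>0, ..., degree P\<close> has degree at most
  \<open>degree P\<close> and agrees with \<open>P\<close> at \<open>degree P + 1\<close> points,
  hence equals it.\<close>

lemma integer_valued_poly_expansion:
  fixes P :: "complex poly"
  assumes "\<And>m :: nat. poly P (of_nat m) \<in> \<int>"
  shows "\<exists>c :: nat \<Rightarrow> int. \<forall>x. poly P x = (\<Sum>k\<le>degree P. of_int (c k) * (x gchoose k))"
proof -
  have "\<forall>m. \<exists>z. poly P (of_nat m) = of_int z"
    using assms by (blast elim: Ints_cases)
  from choice[OF this] obtain f :: "nat \<Rightarrow> int" where f: "\<And>m. poly P (of_nat m) = of_int (f m)" by blast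
  let ?d = "degree P"
  obtain c where c: "\<And>i. i \<le> ?d \<Longrightarrow> (\<Sum>k\<le>?d. c k * int (i choose k)) = f i"
    using newton_interpolation[of ?d f] by blast
  define Q :: "complex poly" where
    "Q = (\<Sum>k\<le>?d. Polynomial.smult (of_int (c k) / fact k) (falling_poly k))"
  have Q: "poly Q x = (\<Sum>k\<le>?d. of_int (c k) * (x gchoose k))" for x
    by (simp add: Q_def poly_sum poly_falling_poly)
  have "P = Q"
  proof (rule poly_eqI_degree[of "of_nat ` {..?d}"])
    fix x :: complex assume "x \<in> of_nat ` {..?d}"
    then obtain i where i: "x = of_nat i" "i \<le> ?d" by auto
    have "poly Q x = of_int (\<Sum>k\<le>?d. c k * int (i choose k))"
      by (simp add: Q i(1) binomial_gbinomial)
    then show "poly P x = poly Q x"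
      using c[OF i(2)] f i(1) by simp
  next
    have card: "card (of_nat ` {..?d} :: complex set) = Suc ?d"
      by (simp add: card_image)
    show "?d < card (of_nat ` {..?d} :: complex set)" by (simp add: card)
    have "degree Q \<le> ?d"
      unfolding Q_def
      by (intro degree_sum_le order.trans[OF degree_smult_le]) (auto simp: degree_falling_poly)
    then show "degree Q < card (of_nat ` {..?d} :: complex set)" by (simp add: card)
  qed
  then show ?thesis using Q by blast
qed

lemma R_plus_integer_valued_poly:
  assumes "\<alpha> ^ n = 1" "\<alpha> \<noteq> 1" "n > 0" and "\<And>m :: nat. poly P (of_nat m) \<in> \<int>"
  shows "poly P \<alpha> \<in> R_plus \<alpha>"
proof -
  have "of_int m * x \<in> R_plus \<alpha>" if "x \<in> R_plus \<alpha>" for m x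
    using that R_plus_uminus[OF assms(1-3)]
    by (cases m rule: int_cases2) (auto intro: R_plus_of_nat_mult)
  moreover obtain c where "poly P \<alpha> = (\<Sum>k\<le>degree P. of_int (c k) * (\<alpha> gchoose k))"
    using integer_valued_poly_expansion[OF assms(4)] by blast
  ultimately show ?thesis
    by (auto intro!: R_plus_sum R_plus_gchoose)
qed

lemma R_plus_obtain_integer_valued_poly:
  assumes "x \<in> R_plus \<alpha>"
  obtains P where "x = poly P \<alpha>" "\<And>m :: nat. poly P (of_nat m) \<in> \<int>"
proof -
  from assms obtain a K where x: "x = (\<Sum>k\<in>K. of_nat (a k) * (\<alpha> gchoose k))"
    unfolding R_plus_def by blast
  let ?P = "\<Sum>k\<in>K. Polynomial.smult (of_nat (a k) / fact k) (falling_poly k) :: complex poly"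
  have P: "poly ?P y = (\<Sum>k\<in>K. of_nat (a k) * (y gchoose k))" for y
    by (simp add: poly_sum poly_falling_poly)
  have "poly ?P (of_nat m) \<in> \<int>" for m
    unfolding P binomial_gbinomial[symmetric] by (intro Ints_sum Ints_mult) auto
  with P x show ?thesis by (intro that[of ?P]) auto
qed

text \<open>Products are formed among integer-valued polynomials, which avoids expanding products of
  binomial coefficients.\<close>

lemma complex_subring_R_plus:
  assumes "\<alpha> ^ n = 1" "\<alpha> \<noteq> 1" "n > 0"
  shows "complex_subring (R_plus \<alpha>)"
proof
  show "1 \<in> R_plus \<alpha>" using R_plus_gchoose[of \<alpha> 0] by simp
next
  fix x y assume "x \<in> R_plus \<alpha>" "y \<in> R_plus \<alpha>"
  then obtain P Q where "x = poly P \<alpha>" "\<And>m :: nat. poly P (of_nat m) \<in> \<int>"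
    "y = poly Q \<alpha>" "\<And>m :: nat. poly Q (of_nat m) \<in> \<int>"
    by (metis R_plus_obtain_integer_valued_poly)
  then show "x * y \<in> R_plus \<alpha>"
    using R_plus_integer_valued_poly[OF assms, of "P * Q"] by simp
qed (use assms in \<open>auto intro: R_plus_add R_plus_uminus\<close>)

lemma R_plus_fermat_quotient:
  assumes "\<alpha> ^ n = 1" "\<alpha> \<noteq> 1" "n > 0" and p: "Factorial_Ring.prime p"
  shows "(\<alpha> ^ p - \<alpha>) / of_nat p \<in> R_plus \<alpha>"
proof -
  let ?P = "Polynomial.smult (1 / of_nat p) (Polynomial.monom 1 p - Polynomial.monom 1 1) :: complex poly"
  have P: "poly ?P x = (x ^ p - x) / of_nat p" for x
    by (simp add: poly_monom)
  have "poly ?P (of_nat m) \<in> \<int>" for m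
  proof -
    have "[m ^ p = m] (mod p)"
    proof (cases "p dvd m")
      case True
      then show ?thesis
        using dvd_trans[OF True dvd_power[of p m]] prime_gt_0_nat[OF p] by (simp add: cong_def)
    next
      case False
      from fermat_theorem[OF p this] have "[m * m ^ (p - 1) = m * 1] (mod p)"
        by (rule cong_scalar_left)
      then show ?thesis
        using prime_gt_0_nat[OF p] by (simp add: power_eq_if)
    qed
    then have "int p dvd int m ^ p - int m"
      by (metis cong_iff_dvd_diff cong_int_iff of_nat_power)
    then obtain t where "int m ^ p - int m = int p * t" ..
    then have "of_int (int m ^ p - int m) = (of_int (int p * t) :: complex)" by (rule arg_cong)
    then have "of_nat m ^ p - of_nat m = (of_nat p * of_int t :: complex)" by simp
    then show ?thesis
      unfolding P using prime_gt_0_nat[OF p] by simp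
  qed
  from R_plus_integer_valued_poly[OF assms(1-3) this] show ?thesis by (simp only: P)
qed

subsection \<open>Roots of unity and inverses of primes\<close>

lemma primitive_root_of_unity_exists:
  assumes "z ^ n = 1" "n > 0"
  shows "\<exists>d. primitive_root_of_unity d z"
proof -
  define d where "d = (LEAST d. d > 0 \<and> z ^ d = 1)"
  have "d > 0 \<and> z ^ d = 1"
    using LeastI[of "\<lambda>d. d > 0 \<and> z ^ d = 1" n] assms by (simp add: d_def)
  moreover have "z ^ k \<noteq> 1" if "0 < k" "k < d" for k
    using not_less_Least[of k "\<lambda>d. d > 0 \<and> z ^ d = 1"] that by (auto simp: d_def)
  ultimately show ?thesis unfolding primitive_root_of_unity_def by blast
qed

lemma primitive_root_of_unity_power_eq_1_iff:
  assumes "primitive_root_of_unity n z"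
  shows "z ^ k = 1 \<longleftrightarrow> n dvd k"
proof -
  have n: "n > 0" "z ^ n = 1" "\<And>k. 0 < k \<Longrightarrow> k < n \<Longrightarrow> z ^ k \<noteq> 1"
    using assms by (auto simp: primitive_root_of_unity_def)
  have "z ^ k = z ^ (n * (k div n) + k mod n)" by simp
  also have "\<dots> = z ^ (k mod n)"
    by (simp only: power_add power_mult n power_one mult_1)
  finally show ?thesis
    using n(1) n(3)[of "k mod n"] by (auto simp: dvd_eq_mod_eq_0)
qed

text \<open>Evaluate at 1 the factorization of \<open>1 + x + ... + x ^ (d - 1)\<close> into the
  linear factors \<open>x - z ^ j\<close>.\<close>

lemma prod_one_minus_root_of_unity_powers:
  assumes "primitive_root_of_unity d z"
  shows "(\<Prod>j\<in>{1..<d}. 1 - z ^ j) = of_nat d"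
proof -
  have d: "d > 0" "z ^ d = 1" "\<And>k. 0 < k \<Longrightarrow> k < d \<Longrightarrow> z ^ k \<noteq> 1"
    using assms by (auto simp: primitive_root_of_unity_def)
  have "z \<noteq> 0" using d by (auto simp: power_0_left)
  have neq: "z ^ i \<noteq> z ^ j" if "i < j" "j < d" for i j
  proof
    assume "z ^ i = z ^ j"
    also have "z ^ j = z ^ i * z ^ (j - i)" using that by (simp flip: power_add)
    finally have "z ^ (j - i) = 1" using \<open>z \<noteq> 0\<close> by simp
    then show False using d(3)[of "j - i"] that by simp
  qed
  have inj: "inj_on ((^) z) {1..<d}"
  proof (rule inj_onI)
    fix i j assume "i \<in> {1..<d}" "j \<in> {1..<d}" "z ^ i = z ^ j"
    then show "i = j" using neq[of i j] neq[of j i] by (cases i j rule: linorder_cases) auto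
  qed
  define P :: "complex poly" where "P = (\<Sum>i<d. Polynomial.monom 1 i)"
  define Q :: "complex poly" where "Q = (\<Prod>j\<in>{1..<d}. [:- (z ^ j), 1:])"
  have degQ: "degree Q = d - 1"
    by (simp add: Q_def degree_prod_eq_sum_degree)
  have "lead_coeff Q = 1"
    by (simp add: Q_def lead_coeff_prod)
  have "P = Q"
  \<comment> \<open>Equal leading coefficients save one interpolation point, so the
    \<open>d - 1\<close> common roots suffice.\<close>
  proof (rule poly_eqI_degree_lead_coeff[of _ "d - 1" _ "(^) z ` {1..<d}"])
    show "poly.coeff P (d - 1) = poly.coeff Q (d - 1)"
      using \<open>lead_coeff Q = 1\<close> d(1) degQ by (simp add: P_def coeff_sum)
    show "d - 1 \<le> card ((^) z ` {1..<d})"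
      using card_image[OF inj] by simp
    show "degree P \<le> d - 1"
      unfolding P_def using d(1)
      by (intro degree_sum_le order.trans[OF degree_monom_le]) auto
    show "degree Q \<le> d - 1" by (simp add: degQ)
  next
    fix x assume "x \<in> (^) z ` {1..<d}"
    then obtain j where j: "j \<in> {1..<d}" "x = z ^ j" by auto
    have "poly Q x = 0"
      using j by (auto simp: Q_def poly_prod)
    moreover have "x ^ d = 1"
      unfolding j(2) by (metis d(2) power_mult power_one mult.commute)
    then have "poly P x = 0"
      using j d(3)[of j] sum_powers_root_of_unity[of x d] by (simp add: P_def poly_sum poly_monom)
    ultimately show "poly P x = poly Q x" by simp
  qed
  then have "poly P 1 = poly Q 1" by simp
  then show ?thesis by (simp add: P_def Q_def poly_sum poly_monom poly_prod)
qed

text \<open>As \<open>d = (1 - z) ^ (d - 1) * w\<close> with \<open>w\<close> in \<open>T\<close>,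
  also \<open>d / p ^ (d - 1)\<close> lies in \<open>T\<close>, and its numerator has fewer than
  \<open>d - 1\<close> factors \<open>p\<close>. In the excluded case \<open>z = -1\<close>, and
  \<open>quot\<close> says only that 1 lies in \<open>T\<close>.\<close>

lemma (in complex_subring) inverse_prime_root_of_unity:
  assumes z: "primitive_root_of_unity d z" "z \<in> T" and "d > 1"
    and p: "Factorial_Ring.prime p" and quot: "(1 - z) / of_nat p \<in> T"
    and "\<not> (p = 2 \<and> d = 2)"
  shows "1 / of_nat p \<in> T"
proof -
  have "p \<ge> 2" using p by (rule prime_ge_2_nat)
  obtain v c where dvc: "d = p ^ v * c" "\<not> p dvd c"
    using multiplicity_decompose'[of d p] p \<open>d > 1\<close> by (metis not_prime_unit not_one_less_zero)
  have "v < d - 1"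
  proof (rule ccontr)
    assume "\<not> v < d - 1"
    have "p ^ v \<le> d" using dvd_imp_le[of "p ^ v" d] dvd_triv_left[of "p ^ v" c] \<open>d > 1\<close>
      unfolding dvc(1)[symmetric] by linarith
    moreover have "p ^ (d - 1) \<le> p ^ v"
      using \<open>\<not> v < d - 1\<close> \<open>p \<ge> 2\<close> by (intro power_increasing) auto
    ultimately have *: "p ^ (d - 1) \<le> d" by linarith
    show False
    \<comment> \<open>The bound \<open>d < 2 ^ (d - 1)\<close> starts at 3; for \<open>d = 2\<close>
      the inequality forces \<open>p = 2\<close>.\<close>
    proof (cases "d = 2")
      case True
      then show False using * \<open>p \<ge> 2\<close> assms(6) by simp
    next
      case False
      then have "d \<ge> 3" using \<open>d > 1\<close> by simp
      then have "d < 2 ^ (d - 1)"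
        by (induction d rule: nat_induct_at_least) (auto simp: power_eq_if)
      also have "\<dots> \<le> p ^ (d - 1)" using \<open>p \<ge> 2\<close> by (intro power_mono) auto
      finally show False using * by simp
    qed
  qed
  \<comment> \<open>Multiplying by \<open>p ^ t\<close> leaves exactly one factor \<open>p\<close>
    in the denominator.\<close>
  define t where "t = d - 2 - v"
  have t: "d - 1 = v + Suc t" using \<open>v < d - 1\<close> by (simp add: t_def)
  \<comment> \<open>Each factor \<open>1 - z ^ j\<close> contributes its cofactor with respect to
    \<open>1 - z\<close>.\<close>
  define w where "w = (\<Prod>j\<in>{1..<d}. \<Sum>i<j. z ^ i)"
  have "w \<in> T" unfolding w_def using z(2) by (intro prod sum power)
  have "of_nat d = (\<Prod>j\<in>{1..<d}. (1 - z) * (\<Sum>i<j. z ^ i))"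
    unfolding prod_one_minus_root_of_unity_powers[OF z(1), symmetric]
    by (simp only: one_diff_power_eq)
  also have "\<dots> = (1 - z) ^ (d - 1) * w"
    by (simp add: prod.distrib w_def)
  finally have d: "of_nat d = (1 - z) ^ (d - 1) * w" .
  have "of_nat p ^ t * (((1 - z) / of_nat p) ^ (d - 1) * w)
      = of_nat p ^ t * (of_nat (p ^ v * c) / of_nat p ^ (v + Suc t))"
    unfolding dvc(1)[symmetric] d t[symmetric] by (simp add: power_divide)
  also have "\<dots> = of_nat c / of_nat p"
    using \<open>p \<ge> 2\<close> by (simp add: power_add)
  finally have "of_nat c / of_nat p \<in> T"
    using quot \<open>w \<in> T\<close> by (metis mult power of_nat)
  then show ?thesis using p dvc(2) by (intro inverse_prime_dvd)
qed

lemma inverse_prime_in_R_plus: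
  assumes n: "n > 2" and z: "primitive_root_of_unity n \<zeta>"
    and p: "Factorial_Ring.prime p" "[p \<noteq> 1] (mod n)"
  shows "1 / of_nat p \<in> R_plus \<zeta>"
proof -
  have pow: "\<zeta> ^ n = 1" and "n > 0" and "\<zeta> \<noteq> 1"
    using n z primitive_root_of_unity_power_eq_1_iff[OF z, of 1]
    by (auto simp: primitive_root_of_unity_def)
  interpret complex_subring "R_plus \<zeta>"
    using complex_subring_R_plus[OF pow \<open>\<zeta> \<noteq> 1\<close> \<open>n > 0\<close>] .
  have "p > 0" using p(1) by (rule prime_gt_0_nat)
  have "\<zeta> \<in> R_plus \<zeta>" using R_plus_gchoose[of \<zeta> 1] by simp
  define \<eta> where "\<eta> = \<zeta> ^ (p - 1)"
  have "\<eta> ^ n = 1"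
    unfolding \<eta>_def by (metis pow power_mult mult.commute power_one)
  then obtain d where d: "primitive_root_of_unity d \<eta>"
    using primitive_root_of_unity_exists \<open>n > 0\<close> by blast
  have "\<not> n dvd p - 1"
    using p(2) \<open>p > 0\<close> by (metis Suc_leI cong_altdef_nat One_nat_def)
  then have "\<eta> \<noteq> 1"
    by (simp add: \<eta>_def primitive_root_of_unity_power_eq_1_iff[OF z])
  then have "d > 1"
    using d by (cases "d = 1") (auto simp: primitive_root_of_unity_def)
  have "\<zeta> ^ (n - 1) * \<zeta> = 1"
    using pow \<open>n > 0\<close> by (metis power_minus_mult)
  \<comment> \<open>Since \<open>\<zeta> ^ (n - 1)\<close> is the inverse of \<open>\<zeta>\<close>,
    this strips the factor \<open>- \<zeta>\<close> from the Fermat quotient.\<close>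
  then have "- (\<zeta> ^ (n - 1)) * ((\<zeta> ^ p - \<zeta>) / of_nat p) = (1 - \<eta>) / of_nat p"
    unfolding power_minus_mult[OF \<open>p > 0\<close>, of \<zeta>, symmetric] \<eta>_def[symmetric]
    by (simp add: field_simps)
  then have quot: "(1 - \<eta>) / of_nat p \<in> R_plus \<zeta>"
    using R_plus_fermat_quotient[OF pow \<open>\<zeta> \<noteq> 1\<close> \<open>n > 0\<close> p(1)] \<open>\<zeta> \<in> R_plus \<zeta>\<close>
    by (metis mult power uminus)
  \<comment> \<open>For \<open>p = 2\<close> one has \<open>\<eta> = \<zeta>\<close>, so order 2
    would contradict \<open>n > 2\<close>.\<close>
  have "\<not> (p = 2 \<and> d = 2)"
  proof
    assume "p = 2 \<and> d = 2"
    then have "\<zeta> ^ 2 = 1" using d by (auto simp: \<eta>_def primitive_root_of_unity_def)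
    then show False using z n by (auto simp: primitive_root_of_unity_def)
  qed
  then show ?thesis
    using d \<open>d > 1\<close> p(1) quot \<open>\<zeta> \<in> R_plus \<zeta>\<close>
    by (intro inverse_prime_root_of_unity[of d \<eta>]) (auto simp: \<eta>_def intro: power)
qed

subsection \<open>Denominators of binomial coefficients at roots of unity\<close>

text \<open>Orthogonality of characters modulo \<open>M\<close>. Since \<open>M\<close> may be
  composite, coprimality of \<open>r ^ l - 1\<close> to \<open>M\<close>, not just
  \<open>r ^ l \<noteq> 1\<close>, is what lets this factor be cancelled from the geometric
  sum.\<close>

lemma cong_sum_powers_root_of_unity:
  fixes r M :: int
  assumes r: "[r ^ n = 1] (mod M)" "\<And>l. 0 < l \<Longrightarrow> l < n \<Longrightarrow> coprime (r ^ l - 1) M"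
    and "n > 0"
  shows "[(\<Sum>s<n. r ^ (s * e)) = (if n dvd e then int n else 0)] (mod M)"
proof -
  have red: "[r ^ e = r ^ (e mod n)] (mod M)"
  proof -
    have "[(r ^ n) ^ (e div n) * r ^ (e mod n) = 1 ^ (e div n) * r ^ (e mod n)] (mod M)"
      using r(1) by (intro cong_mult cong_pow cong_refl)
    then show ?thesis by (simp flip: power_mult power_add)
  qed
  have sum: "(\<Sum>s<n. r ^ (s * e)) = (\<Sum>s<n. (r ^ e) ^ s)"
    by (simp add: power_mult mult.commute flip: power_mult)
  show ?thesis
  proof (cases "n dvd e")
    case True
    then have "[(r ^ e) ^ s = 1] (mod M)" for s
      using cong_pow[OF red, of s] by (simp add: dvd_eq_mod_eq_0)
    then have "[(\<Sum>s<n. (r ^ e) ^ s) = (\<Sum>s<n. 1)] (mod M)"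
      by (intro cong_sum)
    then show ?thesis using True by (simp only: sum) simp
  next
    case False
    have "coprime (r ^ (e mod n) - 1) M"
      using False \<open>n > 0\<close> by (intro r(2)) (auto simp: dvd_eq_mod_eq_0)
    moreover have "[r ^ (e mod n) - 1 = r ^ e - 1] (mod M)"
      using red by (intro cong_diff cong_refl) (rule cong_sym)
    ultimately have "coprime (r ^ e - 1) M"
      by (metis cong_imp_coprime)
    moreover have "[(r ^ n) ^ e - 1 = 1 ^ e - 1] (mod M)"
      using r(1) by (intro cong_diff cong_pow cong_refl)
    then have "M dvd (r ^ e) ^ n - 1"
      by (simp add: cong_0_iff mult.commute flip: power_mult)
    then have "M dvd (r ^ e - 1) * (\<Sum>s<n. (r ^ e) ^ s)"
      by (simp only: power_diff_1_eq)
    ultimately have "M dvd (\<Sum>s<n. (r ^ e) ^ s)"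
      by (simp add: coprime_dvd_mult_right_iff coprime_commute)
    then show ?thesis using False by (simp only: sum) (simp add: cong_0_iff)
  qed
qed

text \<open>
  The sums over residue classes are the coefficients of \<open>F\<close> modulo \<open>x ^ n - 1\<close>; a discrete Fourier
  transform modulo \<open>M\<close> recovers them from the values of \<open>F\<close> at the powers of \<open>r\<close>.
\<close>

lemma dvd_sum_coeffs_residue_class:
  fixes F :: "int poly" and r M :: int
  assumes r: "[r ^ n = 1] (mod M)" "\<And>l. 0 < l \<Longrightarrow> l < n \<Longrightarrow> coprime (r ^ l - 1) M"
    and "j < n" and "coprime (int n) M" and F: "\<And>s. M dvd poly F (r ^ s)"
  shows "M dvd (\<Sum>i | i \<le> degree F \<and> i mod n = j. poly.coeff F i)"
proof -
  \<comment> \<open>The exponent \<open>n - j\<close> stands for \<open>- j\<close> and keeps the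
    inverse transform within natural powers.\<close>
  have dvd_iff: "n dvd i + (n - j) \<longleftrightarrow> i mod n = j" for i
  proof -
    have "int (i + (n - j)) = (int i - int j) + int n" using \<open>j < n\<close> by simp
    then have "n dvd i + (n - j) \<longleftrightarrow> int n dvd int i - int j"
      by (metis dvd_add_triv_right_iff int_dvd_int_iff)
    also have "\<dots> \<longleftrightarrow> i mod n = j mod n"
      by (metis cong_iff_dvd_diff cong_int_iff cong_def)
    finally show ?thesis using \<open>j < n\<close> by simp
  qed
  have "(\<Sum>s<n. poly F (r ^ s) * r ^ (s * (n - j)))
      = (\<Sum>s<n. \<Sum>i\<le>degree F. poly.coeff F i * r ^ (s * (i + (n - j))))"
    by (simp add: poly_altdef sum_distrib_right distrib_left power_add power_mult mult.assoc)
  also have "\<dots> = (\<Sum>i\<le>degree F. poly.coeff F i * (\<Sum>s<n. r ^ (s * (i + (n - j)))))"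
    by (subst sum.swap) (simp add: sum_distrib_left)
  finally have "M dvd (\<Sum>i\<le>degree F. poly.coeff F i * (\<Sum>s<n. r ^ (s * (i + (n - j)))))"
    using F by (metis (no_types, lifting) dvd_sum dvd_mult2)
  moreover have "[(\<Sum>i\<le>degree F. poly.coeff F i * (\<Sum>s<n. r ^ (s * (i + (n - j)))))
      = (\<Sum>i\<le>degree F. poly.coeff F i * (if n dvd i + (n - j) then int n else 0))] (mod M)"
    using r \<open>j < n\<close>
    by (intro cong_sum cong_mult cong_refl cong_sum_powers_root_of_unity) auto
  ultimately have "M dvd (\<Sum>i\<le>degree F. poly.coeff F i * (if i mod n = j then int n else 0))"
    unfolding dvd_iff by (simp add: cong_dvd_iff)
  also have "(\<Sum>i\<le>degree F. poly.coeff F i * (if i mod n = j then int n else 0))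
      = (\<Sum>i | i \<le> degree F \<and> i mod n = j. poly.coeff F i) * int n"
    unfolding sum_distrib_right by (intro sum.mono_neutral_cong_right) auto
  \<comment> \<open>The factor \<open>n\<close> of the inverse transform is a unit modulo
    \<open>M\<close>.\<close>
  finally show ?thesis
    using \<open>coprime (int n) M\<close> by (simp add: coprime_dvd_mult_left_iff coprime_commute)
qed

lemma coprime_if_cong_1: "[p = 1] (mod n) \<Longrightarrow> coprime n p" for n p :: nat
  by (metis cong_imp_coprime cong_sym coprime_1_left coprime_commute)

text \<open>Raise a primitive root modulo \<open>p\<close> to the power
  \<open>p ^ m * ((p - 1) / n)\<close>. Euler's theorem bounds the order modulo the prime power, and
  modulo \<open>p\<close> the order stays \<open>n\<close> because \<open>p ^ m\<close> is coprime
  to \<open>n\<close>.\<close>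

lemma root_of_unity_mod_prime_power:
  assumes p: "Factorial_Ring.prime p" and "[p = 1] (mod n)" and "n > 0"
  obtains r :: nat where "[r ^ n = 1] (mod p ^ m)"
    "\<And>l. 0 < l \<Longrightarrow> l < n \<Longrightarrow> [r ^ l \<noteq> 1] (mod p)"
proof -
  obtain g where g: "g \<in> totatives p" "ord p g = p - 1"
    using residue_prime_has_primroot[OF p] by blast
  have "p > 1" using p by (rule prime_gt_1_nat)
  have "n dvd p - 1"
    using assms(2) \<open>p > 1\<close> by (metis cong_altdef_nat One_nat_def less_imp_le)
  then obtain q where q: "p - 1 = n * q" ..
  then have "q \<noteq> 0" using \<open>p > 1\<close> by (cases "q = 0") auto
  have "coprime g p" using g(1) by (auto simp: totatives_def)
  define e where "e = p ^ m * q"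
  \<comment> \<open>Using \<open>Suc m\<close> gives a totient formula without predecessors, which
    also covers \<open>m = 0\<close>.\<close>
  have "e * n = totient (p ^ Suc m)"
    unfolding totient_prime_power_Suc[OF p] q e_def by (simp only: mult_ac)
  then have "[(g ^ e) ^ n = 1] (mod p ^ Suc m)"
    using euler_theorem[of g "p ^ Suc m"] \<open>coprime g p\<close> by (simp flip: power_mult)
  then have "[(g ^ e) ^ n = 1] (mod p ^ m)"
    by (rule cong_dvd_modulus_nat) simp
  moreover have "[(g ^ e) ^ l \<noteq> 1] (mod p)" if "0 < l" "l < n" for l
  proof
    assume "[(g ^ e) ^ l = 1] (mod p)"
    then have "n * q dvd p ^ m * q * l"
      by (simp only: power_mult[symmetric] ord_divides g(2) q e_def)
    then have "n dvd p ^ m * l"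
      using \<open>q \<noteq> 0\<close> by (simp add: mult_ac)
    moreover have "coprime n (p ^ m)"
      using coprime_if_cong_1[OF assms(2)] by simp
    ultimately show False using that
      by (auto simp: coprime_dvd_mult_right_iff dest: dvd_imp_le)
  qed
  ultimately show thesis by (rule that)
qed

text \<open>Prime factors of \<open>N\<close> are removed one at a time: those satisfying
  \<open>Q\<close> cancel against \<open>c\<close>, the others are inverted in
  \<open>T\<close>.\<close>

lemma (in complex_subring) of_int_divide_of_nat:
  fixes Q :: "nat \<Rightarrow> bool"
  assumes inv: "\<And>p. Factorial_Ring.prime p \<Longrightarrow> \<not> Q p \<Longrightarrow> 1 / of_nat p \<in> T"
    and "N > 0"
    and "\<And>p m. Factorial_Ring.prime p \<Longrightarrow> Q p \<Longrightarrow> p ^ m dvd N \<Longrightarrow> int (p ^ m) dvd c"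
  shows "of_int c / of_nat N \<in> T"
  using assms(2,3)
proof (induction N arbitrary: c rule: less_induct)
  case (less N)
  show ?case
  proof (cases "N = 1")
    case True
    then show ?thesis by (simp add: of_int)
  next
    case False
    then obtain p where p: "Factorial_Ring.prime p" "p dvd N"
      using prime_factor_nat by blast
    then obtain N' where N': "N = p * N'" by blast
    have "p > 1" using p(1) by (rule prime_gt_1_nat)
    have "N' > 0" "N' < N" using N' \<open>p > 1\<close> less.prems(1) by auto
    show ?thesis
    proof (cases "Q p")
      case True
      have "int p dvd c" using less.prems(2)[of p 1] p True by simp
      then obtain c' where c': "c = int p * c'" by blast
      have "int (q ^ m) dvd c'" if q: "Factorial_Ring.prime q" "Q q" "q ^ m dvd N'" for q m
      proof (cases "q = p")
        case True
        \<comment> \<open>A power of \<open>p\<close> dividing \<open>N'\<close> gains one factor in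
          \<open>N\<close>, which pays for the one removed from \<open>c\<close>.\<close>
        have "int (p ^ Suc m) dvd c"
          using q True by (intro less.prems(2) p) (auto simp: N')
        then show ?thesis using \<open>p > 1\<close> by (simp add: c' True)
      next
        case False
        have "int (q ^ m) dvd int p * c'"
          using less.prems(2)[OF q(1,2), of m] q(3) by (simp add: N' c')
        moreover have "coprime (int (q ^ m)) (int p)"
          using primes_coprime[OF q(1) p(1) False] by simp
        ultimately show ?thesis by (simp add: coprime_dvd_mult_right_iff)
      qed
      then have "of_int c' / of_nat N' \<in> T"
        using less.IH \<open>N' > 0\<close> \<open>N' < N\<close> by blast
      then show ?thesis using \<open>p > 1\<close> by (simp add: c' N')
    next
      case False
      have "of_int c / of_nat N' \<in> T"
        using less.IH[OF \<open>N' < N\<close> \<open>N' > 0\<close>] less.prems(2) by (auto simp: N')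
      then have "1 / of_nat p * (of_int c / of_nat N') \<in> T"
        using inv[OF p(1) False] by (rule mult[rotated])
      then show ?thesis by (simp add: N')
    qed
  qed
qed

lemma (in complex_subring) gchoose_root_of_unity:
  assumes "\<zeta> \<in> T" "\<zeta> ^ n = 1" "n > 0"
    and inv: "\<And>p. Factorial_Ring.prime p \<Longrightarrow> [p \<noteq> 1] (mod n) \<Longrightarrow> 1 / of_nat p \<in> T"
  shows "\<zeta> gchoose k \<in> T"
proof -
  let ?F = "falling_poly k :: int poly"
  \<comment> \<open>These are the coefficients of \<open>?F\<close> reduced modulo
    \<open>x ^ n - 1\<close>.\<close>
  define c where "c j = (\<Sum>i | i \<le> k \<and> i mod n = j. poly.coeff ?F i)" for j
  have "fact k * (\<zeta> gchoose k) = (\<Sum>i\<le>k. of_int (poly.coeff ?F i) * \<zeta> ^ i)"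
    unfolding poly_falling_poly[symmetric] poly_altdef degree_falling_poly
    by (simp only: of_int_coeff_falling_poly[symmetric])
  also have "\<dots> = (\<Sum>i\<le>k. of_int (poly.coeff ?F i) * \<zeta> ^ (i mod n))"
  proof (intro sum.cong refl)
    fix i
    have "\<zeta> ^ i = \<zeta> ^ (n * (i div n) + i mod n)" by simp
    then show "of_int (poly.coeff ?F i) * \<zeta> ^ i = of_int (poly.coeff ?F i) * \<zeta> ^ (i mod n)"
      by (simp only: power_add power_mult assms(2) power_one mult_1)
  qed
  also have "\<dots> = (\<Sum>j<n. \<Sum>i\<in>{i\<in>{..k}. i mod n = j}. of_int (poly.coeff ?F i) * \<zeta> ^ (i mod n))"
    using \<open>n > 0\<close> by (subst sum.group) auto
  also have "\<dots> = (\<Sum>j<n. of_int (c j) * \<zeta> ^ j)"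
    by (auto simp: c_def sum_distrib_right intro!: sum.cong)
  finally have "\<zeta> gchoose k = (\<Sum>j<n. of_int (c j) / of_nat (fact k) * \<zeta> ^ j)"
    by (simp add: sum_divide_distrib[symmetric] field_simps)
  moreover have "of_int (c j) / of_nat (fact k) \<in> T" if "j < n" for j
  proof (rule of_int_divide_of_nat[where Q = "\<lambda>p. [p = 1] (mod n)"])
    fix p m assume p: "Factorial_Ring.prime p" "[p = 1] (mod n)" "p ^ m dvd fact k"
    obtain r where r: "[r ^ n = 1] (mod p ^ m)"
      "\<And>l. 0 < l \<Longrightarrow> l < n \<Longrightarrow> [r ^ l \<noteq> 1] (mod p)"
      using root_of_unity_mod_prime_power[OF p(1,2) \<open>n > 0\<close>] by metis
    have "int (p ^ m) dvd (\<Sum>i | i \<le> degree ?F \<and> i mod n = j. poly.coeff ?F i)"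
    proof (rule dvd_sum_coeffs_residue_class[where r = "int r"])
      show "[int r ^ n = 1] (mod int (p ^ m))"
        using r(1) by (metis cong_int_iff of_nat_1 of_nat_power)
      show "coprime (int r ^ l - 1) (int (p ^ m))" if "0 < l" "l < n" for l
      proof -
        have "\<not> int p dvd int r ^ l - 1"
          using r(2)[OF that] by (metis cong_iff_dvd_diff cong_int_iff of_nat_1 of_nat_power)
        then have "coprime (int p) (int r ^ l - 1)"
          using prime_imp_coprime[of "int p"] p(1) by simp
        then show ?thesis by (simp add: coprime_commute)
      qed
      show "coprime (int n) (int (p ^ m))"
        using coprime_if_cong_1[OF p(2)] by simp
      \<comment> \<open>As \<open>r\<close> is a natural number, \<open>?F\<close> takes multiples
        of \<open>fact k\<close> at its powers.\<close>
      have "int (p ^ m) dvd fact k" using p(3) by (metis int_dvd_int_iff of_nat_fact)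
      then show "int (p ^ m) dvd poly ?F (int r ^ s)" for s
        using poly_falling_poly_int[of k "r ^ s"] by (simp add: dvd_mult2)
    qed fact
    then show "int (p ^ m) dvd c j" by (simp only: c_def degree_falling_poly)
  qed (use inv in auto)
  ultimately show ?thesis
    using \<open>\<zeta> \<in> T\<close> by (auto simp del: times_divide_eq_left of_nat_fact intro!: sum mult power)
qed

theorem proposition7p6:
  fixes n :: nat and \<zeta> :: complex
  assumes "n > 2"
    and "primitive_root_of_unity n \<zeta>"
  shows "R_plus \<zeta> =
    generated_subring (insert \<zeta> {1 / of_nat p | p :: nat. Factorial_Ring.prime p \<and> [p \<noteq> 1] (mod n)})"
    (is "_ = generated_subring ?S")
proof
  have pow: "\<zeta> ^ n = 1" and "n > 0" and "\<zeta> \<noteq> 1"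
    using assms primitive_root_of_unity_power_eq_1_iff[OF assms(2), of 1]
    by (auto simp: primitive_root_of_unity_def)
  interpret R: complex_subring "R_plus \<zeta>"
    using complex_subring_R_plus[OF pow \<open>\<zeta> \<noteq> 1\<close> \<open>n > 0\<close>] .
  have "?S \<subseteq> R_plus \<zeta>"
    using inverse_prime_in_R_plus[OF assms] R_plus_gchoose[of \<zeta> 1] by auto
  then show "generated_subring ?S \<subseteq> R_plus \<zeta>"
    by (rule R.generated_subring_subset)
  interpret S: complex_subring "generated_subring ?S"
    by (rule complex_subring_generated)
  have "\<zeta> gchoose k \<in> generated_subring ?S" for k
    using pow \<open>n > 0\<close>
    by (intro S.gchoose_root_of_unity) (auto intro!: generated_subring_incl)
  then show "R_plus \<zeta> \<subseteq> generated_subring ?S"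
    unfolding R_plus_def by (blast intro: S.sum S.mult S.of_nat)
qed

end
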